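(* Let $X$ be a $\Delta$-complex and let $p$ be an odd prime. For each $u\in H^1(X;\mathbb Z_p)$, the $p$-fold Massey product $\langle u,\dots,u\rangle\subseteq H^2(X;\mathbb Z_p)$ is defined and contains the element $-\delta_p(u)$, where $\delta_p\colon H^1(X;\mathbb Z_p)\to H^2(X;\mathbb Z_p)$ is the Bockstein operator associated to the coefficient sequence $0\to\mathbb Z_p\to\mathbb Z_{p^2}\to\mathbb Z_p\to0$.
   Context: $\mathbb Z_n=\mathbb Z/n\mathbb Z$. A $\Delta$-complex is the geometric realization of a $\Delta$-set (sets $X_n$ of $n$-simplices with face maps $d_i$ satisfying $d_id_j=d_{j-1}d_i$ for $i<j$). Cochains $C^*(X;\mathbb Z_p)$ are simplicial cochains, with $(du)(x)=u(\partial x)$, $\partial=\sum(-1)^id_i$, and cup product $(u\cup v)([0,\dots,r+s])=u([0,\dots,r])v([r,\dots,r+s])$ for $u\in C^r,v\in C^s$. For $u_1,\dots,u_n\in H^1$, $n\ge3$, the $n$-fold Massey product $\langle u_1,\dots,u_n\rangle\subseteq H^2$ is the set of classes of cocycles $a_{1}a_{2,n}+a_{1,2}a_{3,n}+\cdots+a_{1,n-1}a_{n}$, where $a_i=a_{i,i}$ are cocycle representatives of $u_i$ and, for $1\le i<j\le n$, $(i,j)\ne(1,n)$, $a_{i,j}$ are $1$-cochains with $da_{i,j}=a_ia_{i+1,j}+a_{i,i+1}a_{i+2,j}+\cdots+a_{i,j-1}a_j$ (products are cup products). It is defined if such cochains exist. The Bockstein is the connecting homomorphism: if $\tilde a\in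 C^1(X;\mathbb Z)$ reduces mod $p$ to a cocycle $a$ and $d\tilde a=p\beta$, then $\delta_p[a]=[\beta\bmod p]$. *)

theory Defs
  imports "HOL-Algebra.Product_Groups" "HOL-Number_Theory.Residues"
begin

(* face X n i is the face map d_i on n-simplices; only 0 <= i <= n and n >= 1 are meaningful.
   Simplices of different dimensions may be represented by the same element of 'a. *)
record 'a delta_data =
  simplices :: "nat \<Rightarrow> 'a set"
  face :: "nat \<Rightarrow> nat \<Rightarrow> 'a \<Rightarrow> 'a"

locale delta_set =
  fixes X :: "'a delta_data"
  assumes face_closed:
      "\<And>n i x. i \<le> Suc n \<Longrightarrow> x \<in> simplices X (Suc n) \<Longrightarrow> face X (Suc n) i x \<in> simplices X n"
    and face_face:
      "\<And>n i j x. i < j \<Longrightarrow> j \<le> Suc (Suc n) \<Longrightarrow> x \<in> simplices X (Suc (Suc n)) \<Longrightarrow>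
         face X (Suc n) i (face X (Suc (Suc n)) j x)
           = face X (Suc n) (j - 1) (face X (Suc (Suc n)) i x)"

(* The additive group of cochains. As everywhere in HOL-Algebra groups, the group law is written
   multiplicatively, so inv in this group and in its quotients is negation. Cochains are
   extensional functions (undefined outside the n-simplices). *)
definition cochain_group :: "'a delta_data \<Rightarrow> ('r, 'm) ring_scheme \<Rightarrow> nat \<Rightarrow> ('a \<Rightarrow> 'r) monoid" where
  "cochain_group X R n = product_group (simplices X n) (\<lambda>_. add_monoid R)"

definition coboundary ::
  "'a delta_data \<Rightarrow> ('r, 'm) ring_scheme \<Rightarrow> nat \<Rightarrow> ('a \<Rightarrow> 'r) \<Rightarrow> 'a \<Rightarrow> 'r" where
  "coboundary X R n u =
     (\<lambda>x\<in>simplices X (Suc n).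
        \<Oplus>\<^bsub>R\<^esub>i\<in>{..Suc n}. if even i then u (face X (Suc n) i x)
                          else \<ominus>\<^bsub>R\<^esub> u (face X (Suc n) i x))"

definition cocycles :: "'a delta_data \<Rightarrow> ('r, 'm) ring_scheme \<Rightarrow> nat \<Rightarrow> ('a \<Rightarrow> 'r) set" where
  "cocycles X R n = kernel (cochain_group X R n) (cochain_group X R (Suc n)) (coboundary X R n)"

definition coboundaries :: "'a delta_data \<Rightarrow> ('r, 'm) ring_scheme \<Rightarrow> nat \<Rightarrow> ('a \<Rightarrow> 'r) set" where
  "coboundaries X R n =
     (case n of 0 \<Rightarrow> {\<one>\<^bsub>cochain_group X R 0\<^esub>}
      | Suc m \<Rightarrow> coboundary X R m ` carrier (cochain_group X R m))"

definition cohomology_group ::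
  "'a delta_data \<Rightarrow> ('r, 'm) ring_scheme \<Rightarrow> nat \<Rightarrow> ('a \<Rightarrow> 'r) set monoid" where
  "cohomology_group X R n =
     (cochain_group X R n)\<lparr>carrier := cocycles X R n\<rparr> Mod coboundaries X R n"

definition cohomology_class ::
  "'a delta_data \<Rightarrow> ('r, 'm) ring_scheme \<Rightarrow> nat \<Rightarrow> ('a \<Rightarrow> 'r) \<Rightarrow> ('a \<Rightarrow> 'r) set" where
  "cohomology_class X R n z = coboundaries X R n #>\<^bsub>cochain_group X R n\<^esub> z"

(* For an (r+s)-simplex x: the front r-face [0,...,r], obtained by applying the last face map
   s times, and the back s-face [r,...,r+s], obtained by applying d_0 r times. *)
fun front_face :: "'a delta_data \<Rightarrow> nat \<Rightarrow> nat \<Rightarrow> 'a \<Rightarrow> 'a" where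
  "front_face X r 0 x = x"
| "front_face X r (Suc s) x = front_face X r s (face X (r + Suc s) (r + Suc s) x)"

fun back_face :: "'a delta_data \<Rightarrow> nat \<Rightarrow> nat \<Rightarrow> 'a \<Rightarrow> 'a" where
  "back_face X 0 s x = x"
| "back_face X (Suc r) s x = back_face X r s (face X (Suc r + s) 0 x)"

definition cup ::
  "'a delta_data \<Rightarrow> ('r, 'm) ring_scheme \<Rightarrow> nat \<Rightarrow> nat \<Rightarrow> ('a \<Rightarrow> 'r) \<Rightarrow> ('a \<Rightarrow> 'r) \<Rightarrow> 'a \<Rightarrow> 'r" where
  "cup X R r s u v =
     (\<lambda>x\<in>simplices X (r + s). u (front_face X r s x) \<otimes>\<^bsub>R\<^esub> v (back_face X r s x))"

(* The 2-cochain a_i a_{i+1,j} + a_{i,i+1} a_{i+2,j} + ... + a_{i,j-1} a_j. *)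
definition massey_sum ::
  "'a delta_data \<Rightarrow> ('r, 'm) ring_scheme \<Rightarrow> (nat \<Rightarrow> nat \<Rightarrow> 'a \<Rightarrow> 'r) \<Rightarrow> nat \<Rightarrow> nat \<Rightarrow> 'a \<Rightarrow> 'r" where
  "massey_sum X R a i j =
     (\<lambda>x\<in>simplices X 2. \<Oplus>\<^bsub>R\<^esub>k\<in>{i..<j}. cup X R 1 1 (a i k) (a (Suc k) j) x)"

(* Elements of cohomology groups are cosets, so a_i representing u_i is membership. *)
definition massey_defining_system ::
  "'a delta_data \<Rightarrow> ('r, 'm) ring_scheme \<Rightarrow> nat \<Rightarrow> (nat \<Rightarrow> ('a \<Rightarrow> 'r) set)
     \<Rightarrow> (nat \<Rightarrow> nat \<Rightarrow> 'a \<Rightarrow> 'r) \<Rightarrow> bool" where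
  "massey_defining_system X R n u a \<longleftrightarrow>
     (\<forall>i\<in>{1..n}. a i i \<in> u i) \<and>
     (\<forall>i j. 1 \<le> i \<and> i < j \<and> j \<le> n \<and> (i, j) \<noteq> (1, n) \<longrightarrow>
        a i j \<in> carrier (cochain_group X R 1) \<and>
        coboundary X R 1 (a i j) = massey_sum X R a i j)"

(* The Massey product of u 1, ..., u n in H^1(X; R), for n >= 3. *)
definition massey_product ::
  "'a delta_data \<Rightarrow> ('r, 'm) ring_scheme \<Rightarrow> nat \<Rightarrow> (nat \<Rightarrow> ('a \<Rightarrow> 'r) set) \<Rightarrow> ('a \<Rightarrow> 'r) set set" where
  "massey_product X R n u =
     {cohomology_class X R 2 (massey_sum X R a 1 n) |a. massey_defining_system X R n u a}"

definition massey_product_defined ::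
  "'a delta_data \<Rightarrow> ('r, 'm) ring_scheme \<Rightarrow> nat \<Rightarrow> (nat \<Rightarrow> ('a \<Rightarrow> 'r) set) \<Rightarrow> bool" where
  "massey_product_defined X R n u \<longleftrightarrow> (\<exists>a. massey_defining_system X R n u a)"

(* The connecting map H^n(X; C) -> H^(n+1)(X; A) of a short exact coefficient sequence
   0 -> A -f-> B -g-> C -> 0: lift a representative of U along g, take the coboundary, and pull
   back along f. The set of all outcomes, over all representatives and lifts, is exactly one
   coset of the coboundaries: two lifts of representatives of U differ by a coboundary plus
   the f-image of a cochain. *)
definition connecting_map ::
  "'a delta_data \<Rightarrow> ('r, 'm) ring_scheme \<Rightarrow> ('s, 'k) ring_scheme \<Rightarrow> ('r \<Rightarrow> 's) \<Rightarrow> ('s \<Rightarrow> 't)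
     \<Rightarrow> nat \<Rightarrow> ('a \<Rightarrow> 't) set \<Rightarrow> ('a \<Rightarrow> 'r) set" where
  "connecting_map X A B f g n U =
     {b \<in> carrier (cochain_group X A (Suc n)).
        \<exists>a\<in>carrier (cochain_group X B n).
          (\<lambda>x\<in>simplices X n. g (a x)) \<in> U \<and>
          coboundary X B n a = (\<lambda>x\<in>simplices X (Suc n). f (b x))}"

(* The coefficient sequence is 0 -> Z_p -> Z_{p^2} -> Z_p -> 0, where Z_m is represented by the
   residues 0, ..., m - 1. *)
definition bockstein :: "'a delta_data \<Rightarrow> nat \<Rightarrow> ('a \<Rightarrow> int) set \<Rightarrow> ('a \<Rightarrow> int) set" where
  "bockstein X p =
     connecting_map X (residue_ring (int p)) (residue_ring (int p ^ 2))
       (\<lambda>t. int p * t) (\<lambda>t. t mod int p) 1"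

lemma finsum_residue_ring:
  assumes "m > 1" "finite A" "\<And>i. i \<in> A \<Longrightarrow> g i \<in> {0..m - 1}"
  shows "(\<Oplus>\<^bsub>residue_ring m\<^esub>i\<in>A. g i) = (\<Sum>i\<in>A. g i) mod m"
proof -
  interpret residues m "residue_ring m" by unfold_locales (use assms in auto)
  show ?thesis using assms(2,3)
  proof (induction A rule: finite_induct)
    case empty then show ?case by (simp add: res_zero_eq)
  next
    case (insert a A)
    then have "(\<Oplus>\<^bsub>residue_ring m\<^esub>i\<in>insert a A. g i)
        = g a \<oplus>\<^bsub>residue_ring m\<^esub> (\<Oplus>\<^bsub>residue_ring m\<^esub>i\<in>A. g i)"
      by (subst finsum_insert) (auto simp: res_carrier_eq)
    with insert show ?case by (simp add: res_add_eq mod_add_right_eq)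
  qed
qed

lemma coboundary_residue_ring:
  assumes "delta_set X" "m > 1" "x \<in> simplices X (Suc n)"
  shows "coboundary X (residue_ring m) n (\<lambda>y\<in>simplices X n. a y mod m) x
           = (\<Sum>i\<le>Suc n. (-1) ^ i * a (face X (Suc n) i x)) mod m"
proof -
  interpret delta_set X by fact
  interpret residues m "residue_ring m" by unfold_locales (use assms in auto)
  have *: "(if even i then (\<lambda>y\<in>simplices X n. a y mod m) (face X (Suc n) i x)
         else \<ominus>\<^bsub>residue_ring m\<^esub> (\<lambda>y\<in>simplices X n. a y mod m) (face X (Suc n) i x))
        = ((-1) ^ i * a (face X (Suc n) i x)) mod m" if "i \<in> {..Suc n}" for i
    using that assms(3) by (auto simp: face_closed res_neg_eq mod_minus_eq)
  have "coboundary X (residue_ring m) n (\<lambda>y\<in>simplices X n. a y mod m) x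
     = (\<Oplus>\<^bsub>residue_ring m\<^esub>i\<in>{..Suc n}. ((-1) ^ i * a (face X (Suc n) i x)) mod m)"
    unfolding coboundary_def restrict_apply'[OF assms(3)]
    by (intro finsum_cong' refl *) (use assms(2) in \<open>auto simp: res_carrier_eq\<close>)
  also have "\<dots> = (\<Sum>i\<in>{..Suc n}. ((-1) ^ i * a (face X (Suc n) i x)) mod m) mod m"
    by (rule finsum_residue_ring) (use assms in auto)
  finally show ?thesis by (simp only: mod_sum_eq)
qed

(* The description by integral lifts: if the integral 1-cochain a reduces mod p to a representative
   of u and da = p b, then b mod p represents the Bockstein of u. *)
lemma bockstein_integral_lift:
  assumes "delta_set X" "p > 1"
    and "(\<lambda>x\<in>simplices X 1. a x mod int p) \<in> u"
    and "\<And>x. x \<in> simplices X 2 \<Longrightarrow> (\<Sum>i\<le>2. (-1) ^ i * a (face X 2 i x)) = int p * b x"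
  shows "(\<lambda>x\<in>simplices X 2. b x mod int p) \<in> bockstein X p u"
proof -
  have p2: "int p ^ 2 > 1" using assms(2) by (simp add: one_less_power)
  let ?a = "\<lambda>x\<in>simplices X 1. a x mod (int p)^2"
  have S: "Suc 1 = 2" by simp
  have 1: "coboundary X (residue_ring (int p ^ 2)) 1 ?a x = int p * (b x mod int p)"
    if "x \<in> simplices X 2" for x
    using coboundary_residue_ring[OF assms(1) p2, where n = 1 and x = x and a = a, unfolded S] that
    by (simp only: assms(4)[OF that] S power2_eq_square mult_mod_right)
  have 2: "coboundary X (residue_ring (int p ^ 2)) 1 ?a
     = (\<lambda>x\<in>simplices X 2. int p * ((\<lambda>x\<in>simplices X 2. b x mod int p) x))"
  proof
    fix x show "coboundary X (residue_ring (int p ^ 2)) 1 ?a x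
     = (\<lambda>x\<in>simplices X 2. int p * ((\<lambda>x\<in>simplices X 2. b x mod int p) x)) x"
      using 1[of x] by (cases "x \<in> simplices X 2") (auto simp: coboundary_def numeral_2_eq_2)
  qed
  have 3: "(\<lambda>x\<in>simplices X 1. ?a x mod int p) = (\<lambda>x\<in>simplices X 1. a x mod int p)"
    by (rule restrict_ext) (simp add: mod_mod_cancel)
  have 4: "?a \<in> carrier (cochain_group X (residue_ring (int p ^ 2)) 1)"
    using p2 assms(2) by (auto simp: cochain_group_def residue_ring_def)
  have 5: "(\<lambda>x\<in>simplices X 2. b x mod int p) \<in> carrier (cochain_group X (residue_ring (int p)) 2)"
    using assms(2) by (auto simp: cochain_group_def residue_ring_def)
  show ?thesis unfolding bockstein_def connecting_map_def S
    using 2 3 4 5 assms(3) by (auto intro!: bexI[of _ ?a])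
qed

end

theory Submission
  imports Defs
begin

text \<open>
  All cochains over \<open>\<int>\<^sub>m\<close> are reductions of integral cochains, so the computation takes place over
  \<open>\<int>\<close>. Let \<open>A\<close> be an integral 1-cochain whose reduction mod \<open>p\<close> represents \<open>u\<close>, and let \<open>x\<close> be a
  2-simplex with edges \<open>w = A[0,1]\<close>, \<open>y = A[1,2]\<close>, \<open>z = A[0,2]\<close>; the cocycle condition is
  \<open>z \<equiv> w + y (mod p)\<close>. The signed divided powers \<open>c\<^sub>n = (-1)\<^bsup>n+1\<^esup> A\<^bsup>n\<^esup> / n!\<close>, where \<open>1 / n!\<close> is an
  inverse mod \<open>p\<close>, make sense for \<open>n < p\<close>. By the binomial theorem for \<open>(w + y)\<^bsup>n\<^esup>\<close> they satisfy
  \<open>dc\<^sub>n = c\<^sub>1 c\<^bsub>n-1\<^esub> + \<dots> + c\<^bsub>n-1\<^esub> c\<^sub>1\<close>, so that \<open>a\<^bsub>i,j\<^esub> = c\<^bsub>j-i+1\<^esub>\<close> is a defining system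
  (\<open>signed_divided_power_coboundary\<close>).

  The resulting Massey cocycle is \<open>-\<Sum>\<^bsub>0<k<p\<^esub> w\<^bsup>k\<^esup> y\<^bsup>p-k\<^esup> / (k! (p-k)!)\<close>, as \<open>p\<close> is odd. Wilson's theorem
  \<open>(p-1)! \<equiv> -1\<close> turns it into \<open>\<Sum>\<^bsub>0<k<p\<^esub> (1/p) (p choose k) w\<^bsup>k\<^esup> y\<^bsup>p-k\<^esup> = ((w+y)\<^bsup>p\<^esup> - w\<^bsup>p\<^esup> - y\<^bsup>p\<^esup>) / p\<close>.
  On the other hand \<open>A\<^bsup>p\<^esup>\<close> is, by Fermat's theorem, another integral lift of the representative of \<open>u\<close>,
  and \<open>z\<^bsup>p\<^esup> \<equiv> (w+y)\<^bsup>p\<^esup> (mod p\<^sup>2)\<close>. Hence \<open>d(A\<^bsup>p\<^esup>) / p = (y\<^bsup>p\<^esup> - z\<^bsup>p\<^esup> + w\<^bsup>p\<^esup>) / p\<close>, which represents the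
  Bockstein of \<open>u\<close>, is mod \<open>p\<close> exactly the negative of the Massey cocycle
  (\<open>signed_divided_power_top_sum\<close>).

  Two facts carry this cochain identity to cohomology. The Bockstein, given as the set of all
  outcomes of the connecting construction, is the coset of any single outcome
  (\<open>bockstein_eq_cohomology_class\<close>), and inversion in the cohomology group is negation of
  representatives (\<open>inv_cohomology_class\<close>).
\<close>

section \<open>Integral cochains and their reductions\<close>

text \<open>The coboundary of an integral \<open>n\<close>-cochain. Integral cochains are arbitrary functions on the
  underlying type: their values off the \<open>n\<close>-simplices play no role, and \<open>int_coboundary X n a\<close> is
  meaningful only on the \<open>(n+1)\<close>-simplices.\<close>

definition int_coboundary :: "'a delta_data \<Rightarrow> nat \<Rightarrow> ('a \<Rightarrow> int) \<Rightarrow> 'a \<Rightarrow> int" where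
  "int_coboundary X n a x = (\<Sum>i\<le>Suc n. (-1) ^ i * a (face X (Suc n) i x))"

text \<open>The image of an integral \<open>n\<close>-cochain in \<open>C\<^bsup>n\<^esup>(X; \<int>\<^sub>m)\<close>.\<close>

definition reduce :: "'a delta_data \<Rightarrow> int \<Rightarrow> nat \<Rightarrow> ('a \<Rightarrow> int) \<Rightarrow> 'a \<Rightarrow> int" where
  "reduce X m n a = (\<lambda>x\<in>simplices X n. a x mod m)"

lemma int_coboundary_add:
  "int_coboundary X n (\<lambda>e. a e + b e) x = int_coboundary X n a x + int_coboundary X n b x"
  by (simp add: int_coboundary_def algebra_simps sum.distrib del: sum.atMost_Suc)

lemma int_coboundary_mult:
  "int_coboundary X n (\<lambda>e. k * a e) x = k * int_coboundary X n a x"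
  by (simp add: int_coboundary_def sum_distrib_left mult.left_commute del: sum.atMost_Suc)

lemma int_coboundary_1:
  "int_coboundary X 1 a x = a (face X 2 0 x) - a (face X 2 1 x) + a (face X 2 2 x)"
proof -
  have "{..Suc 1} = {0, 1, 2::nat}" by auto
  then show ?thesis by (simp add: int_coboundary_def numeral_2_eq_2)
qed

lemma (in delta_set) int_coboundary_cong:
  assumes "x \<in> simplices X (Suc n)"
    and "\<And>e. e \<in> simplices X n \<Longrightarrow> [a e = b e] (mod m)"
  shows "[int_coboundary X n a x = int_coboundary X n b x] (mod m)"
  unfolding int_coboundary_def
  by (intro cong_sum cong_mult cong_refl assms(2)) (use assms(1) in \<open>auto intro: face_closed\<close>)

lemma (in delta_set) int_coboundary_cong_eq:
  assumes "x \<in> simplices X (Suc n)" and "\<And>e. e \<in> simplices X n \<Longrightarrow> a e = b e"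
  shows "int_coboundary X n a x = int_coboundary X n b x"
  unfolding int_coboundary_def
  by (intro sum.cong refl arg_cong2[where f = "(*)"] assms(2)) (use assms(1) in \<open>auto intro: face_closed\<close>)

text \<open>The identity \<open>dd = 0\<close>.\<close>

lemma (in delta_set) int_coboundary_int_coboundary:
  assumes x: "x \<in> simplices X (Suc (Suc n))"
  shows "int_coboundary X (Suc n) (int_coboundary X n a) x = 0"
proof -
  define f where "f = (\<lambda>(i, j). (-1::int) ^ (i + j) *
    a (face X (Suc n) i (face X (Suc (Suc n)) j x)))"
  define L where "L = {(i, j). i < j \<and> j \<le> Suc (Suc n)}"
  define U where "U = {(i, j). j \<le> i \<and> i \<le> Suc n}"
  have fin: "finite L" "finite U"
    by (rule finite_subset[of _ "{..Suc (Suc n)} \<times> {..Suc (Suc n)}"]; auto simp: L_def U_def)+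
  have LU: "{..Suc n} \<times> {..Suc (Suc n)} = L \<union> U" "L \<inter> U = {}"
    by (auto simp: L_def U_def)
  have "int_coboundary X (Suc n) (int_coboundary X n a) x
      = (\<Sum>j\<le>Suc (Suc n). \<Sum>i\<le>Suc n. f (i, j))"
    unfolding int_coboundary_def f_def sum_distrib_left
    by (simp only: prod.case power_add mult.assoc mult.left_commute mult.commute)
  also have "\<dots> = sum f ({..Suc n} \<times> {..Suc (Suc n)})"
    by (subst sum.swap) (simp only: sum.cartesian_product case_prod_eta)
  also have "\<dots> = sum f L + sum f U"
    unfolding LU(1) using fin LU(2) by (rule sum.union_disjoint)
  \<comment> \<open>The face identity \<open>d\<^sub>i d\<^sub>j = d\<^bsub>j-1\<^esub> d\<^sub>i\<close> pairs the term \<open>(i, j)\<close>, \<open>i < j\<close>, with \<open>(j - 1, i)\<close>,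
    which has the opposite sign.\<close>
  also have "sum f L = - sum f U"
    unfolding sum_negf[symmetric]
  proof (rule sum.reindex_bij_witness[where j = "\<lambda>(i, j). (j - 1, i)" and i = "\<lambda>(i, j). (j, Suc i)"])
    fix q assume q: "q \<in> L"
    then obtain i j where ij: "q = (i, j)" "i < j" "j \<le> Suc (Suc n)" by (auto simp: L_def)
    then obtain k where k: "j = Suc k" by (cases j) auto
    show "- f (case q of (i, j) \<Rightarrow> (j - 1, i)) = f q"
      using face_face[OF ij(2,3) x] ij by (simp add: f_def k add.commute)
  qed (auto simp: L_def U_def)
  finally show ?thesis by simp
qed

section \<open>Cohomology over residue rings\<close>

text \<open>Cochains of a \<open>\<Delta>\<close>-set over \<open>\<int>\<^sub>m\<close>. Every such cochain is the reduction of an integral one, which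
  translates all operations into integral arithmetic.\<close>

locale residue_cochains = delta_set X for X :: "'a delta_data" +
  fixes m :: int
  assumes m_gt_1: "m > 1"
begin

abbreviation R where "R \<equiv> residue_ring m"

sublocale R: residues m R
  by unfold_locales (use m_gt_1 in auto)

lemma reduce_eq_iff:
  "reduce X m n a = reduce X m n b \<longleftrightarrow> (\<forall>x\<in>simplices X n. [a x = b x] (mod m))"
  by (auto simp: reduce_def cong_def fun_eq_iff restrict_def)

lemma reduce_in_carrier: "reduce X m n a \<in> carrier (cochain_group X R n)"
  by (auto simp: reduce_def cochain_group_def)

lemma reduce_self:
  assumes "c \<in> carrier (cochain_group X R n)"
  shows "reduce X m n c = c"
proof
  fix x show "reduce X m n c x = c x"
    using assms
    by (cases "x \<in> simplices X n")
      (auto simp: reduce_def cochain_group_def R.res_carrier_eq PiE_iff extensional_def)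
qed

lemma carrier_cochain_group: "carrier (cochain_group X R n) = range (reduce X m n)"
  using reduce_self reduce_in_carrier by (metis rangeI image_subsetI subsetI subset_antisym)

lemma comm_group_cochain_group: "comm_group (cochain_group X R n)"
proof -
  have "group (cochain_group X R n)"
    unfolding cochain_group_def by (intro product_group R.add.group_axioms)
  then show ?thesis
    by (rule group.group_comm_groupI)
      (auto simp: cochain_group_def PiE_iff intro!: restrict_ext R.add.m_comm)
qed

lemma mult_reduce:
  "reduce X m n a \<otimes>\<^bsub>cochain_group X R n\<^esub> reduce X m n b = reduce X m n (\<lambda>x. a x + b x)"
  by (auto simp: reduce_def cochain_group_def R.add_cong intro!: restrict_ext)

lemma one_reduce: "\<one>\<^bsub>cochain_group X R n\<^esub> = reduce X m n (\<lambda>_. 0)"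
  by (auto simp: reduce_def cochain_group_def R.res_zero_eq intro!: restrict_ext)

lemma inv_reduce: "inv\<^bsub>cochain_group X R n\<^esub> reduce X m n a = reduce X m n (\<lambda>x. - a x)"
proof -
  interpret C: comm_group "cochain_group X R n" by (rule comm_group_cochain_group)
  show ?thesis
    by (rule C.inv_equality) (auto simp: mult_reduce one_reduce intro: reduce_in_carrier)
qed

lemma coboundary_reduce: "coboundary X R n (reduce X m n a) = reduce X m (Suc n) (int_coboundary X n a)"
proof
  fix x show "coboundary X R n (reduce X m n a) x = reduce X m (Suc n) (int_coboundary X n a) x"
    using coboundary_residue_ring[OF delta_set_axioms m_gt_1, of x n a]
    by (cases "x \<in> simplices X (Suc n)")
      (auto simp: reduce_def int_coboundary_def coboundary_def simp del: sum.atMost_Suc)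
qed

lemma coboundary_hom:
  "group_hom (cochain_group X R n) (cochain_group X R (Suc n)) (coboundary X R n)"
  by (intro group_hom.intro group_hom_axioms.intro comm_group.axioms(2) comm_group_cochain_group homI)
    (auto simp: carrier_cochain_group mult_reduce coboundary_reduce, simp add: reduce_eq_iff int_coboundary_add)

lemma reduce_in_cocycles:
  "reduce X m n a \<in> cocycles X R n \<longleftrightarrow> (\<forall>x\<in>simplices X (Suc n). [int_coboundary X n a x = 0] (mod m))"
  by (simp add: cocycles_def kernel_def reduce_in_carrier coboundary_reduce one_reduce reduce_eq_iff)

lemma coboundaries_Suc:
  "coboundaries X R (Suc n) = range (\<lambda>c. reduce X m (Suc n) (int_coboundary X n c))"
  by (simp add: coboundaries_def carrier_cochain_group image_image coboundary_reduce)

lemma subgroup_cocycles: "subgroup (cocycles X R n) (cochain_group X R n)"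
  unfolding cocycles_def by (rule group_hom.subgroup_kernel[OF coboundary_hom])

lemma subgroup_coboundaries: "subgroup (coboundaries X R (Suc n)) (cochain_group X R (Suc n))"
  unfolding coboundaries_def using group_hom.img_is_subgroup[OF coboundary_hom] by simp

lemma coboundaries_subset_cocycles: "coboundaries X R (Suc n) \<subseteq> cocycles X R (Suc n)"
  by (auto simp: coboundaries_Suc reduce_in_cocycles int_coboundary_int_coboundary)

lemma cohomology_class_reduce:
  "cohomology_class X R (Suc n) (reduce X m (Suc n) z)
     = range (\<lambda>c. reduce X m (Suc n) (\<lambda>x. int_coboundary X n c x + z x))"
  by (auto simp: cohomology_class_def r_coset_def coboundaries_Suc mult_reduce)

lemma cohomology_classE:
  assumes "u \<in> carrier (cohomology_group X R n)"
  obtains a where "reduce X m n a \<in> cocycles X R n" "u = cohomology_class X R n (reduce X m n a)"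
proof -
  obtain z where z: "z \<in> cocycles X R n" "u = cohomology_class X R n z"
    using assms by (auto simp: cohomology_group_def carrier_FactGroup cohomology_class_def r_coset_def)
  moreover have "reduce X m n z = z"
    using z(1) by (intro reduce_self) (simp add: cocycles_def kernel_def)
  ultimately show thesis using that[of z] by simp
qed

lemma inv_cohomology_class:
  assumes "reduce X m (Suc n) z \<in> cocycles X R (Suc n)"
  shows "inv\<^bsub>cohomology_group X R (Suc n)\<^esub> cohomology_class X R (Suc n) (reduce X m (Suc n) z)
           = cohomology_class X R (Suc n) (reduce X m (Suc n) (\<lambda>x. - z x))"
proof -
  let ?C = "cochain_group X R (Suc n)" and ?Z = "cocycles X R (Suc n)"
    and ?B = "coboundaries X R (Suc n)"
  interpret C: comm_group ?C by (rule comm_group_cochain_group)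
  interpret Z: comm_group "?C\<lparr>carrier := ?Z\<rparr>"
    by (rule group.group_comm_groupI)
      (use subgroup.subgroup_is_group[OF subgroup_cocycles C.is_group] C.m_comm
        subgroup.mem_carrier[OF subgroup_cocycles] in auto)
  interpret B: normal ?B "?C\<lparr>carrier := ?Z\<rparr>"
    by (intro Z.subgroup_imp_normal C.subgroup_incl subgroup_coboundaries subgroup_cocycles
        coboundaries_subset_cocycles)
  have rc: "?B #>\<^bsub>?C\<lparr>carrier := ?Z\<rparr>\<^esub> y = cohomology_class X R (Suc n) y" for y
    by (simp add: cohomology_class_def r_coset_def)
  have "inv\<^bsub>cohomology_group X R (Suc n)\<^esub> (?B #>\<^bsub>?C\<lparr>carrier := ?Z\<rparr>\<^esub> reduce X m (Suc n) z)
      = ?B #>\<^bsub>?C\<lparr>carrier := ?Z\<rparr>\<^esub> (inv\<^bsub>?C\<lparr>carrier := ?Z\<rparr>\<^esub> reduce X m (Suc n) z)"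
    unfolding cohomology_group_def using assms
    by (subst B.inv_FactGroup, force simp: carrier_FactGroup, intro B.rcos_inv) simp
  also have "inv\<^bsub>?C\<lparr>carrier := ?Z\<rparr>\<^esub> reduce X m (Suc n) z = reduce X m (Suc n) (\<lambda>x. - z x)"
    using C.m_inv_consistent[OF subgroup_cocycles assms] by (simp add: inv_reduce)
  finally show ?thesis by (simp only: rc)
qed

text \<open>The front edge of a 2-simplex is its face \<open>d\<^sub>2\<close>, the back edge its face \<open>d\<^sub>0\<close>.\<close>

lemma massey_sum_reduce:
  assumes "\<And>i j. a i j = reduce X m 1 (b i j)"
  shows "massey_sum X R a i j
     = reduce X m 2 (\<lambda>x. \<Sum>k\<in>{i..<j}. b i k (face X 2 2 x) * b (Suc k) j (face X 2 0 x))"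
proof
  fix x
  show "massey_sum X R a i j x
      = reduce X m 2 (\<lambda>x. \<Sum>k\<in>{i..<j}. b i k (face X 2 2 x) * b (Suc k) j (face X 2 0 x)) x"
  proof (cases "x \<in> simplices X 2")
    case True
    then have x: "x \<in> simplices X (Suc (Suc 0))" by (simp add: numeral_2_eq_2)
    have "cup X R 1 1 (a i k) (a (Suc k) j) x
        = (b i k (face X 2 2 x) * b (Suc k) j (face X 2 0 x)) mod m" for k
      using x by (simp add: cup_def assms reduce_def face_closed R.mult_cong numeral_2_eq_2)
    with True show ?thesis
      by (simp add: massey_sum_def reduce_def R.sum_cong)
  qed (simp add: massey_sum_def reduce_def)
qed

end

section \<open>The Bockstein as a coset\<close>

text \<open>A single integral lift determines the Bockstein completely: any other lift mod \<open>p\<^sup>2\<close> of a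
  representative differs from \<open>a\<close> by \<open>de + pc\<close>, which changes \<open>b\<close> by \<open>dc\<close>.\<close>

lemma (in delta_set) bockstein_eq_cohomology_class:
  assumes p: "p > 1"
    and u: "u = cohomology_class X (residue_ring (int p)) 1 (reduce X (int p) 1 a)"
    and da: "\<And>x. x \<in> simplices X 2 \<Longrightarrow> int_coboundary X 1 a x = int p * b x"
  shows "bockstein X p u = cohomology_class X (residue_ring (int p)) 2 (reduce X (int p) 2 b)"
proof -
  have p2: "int p ^ 2 > 1" using p by (simp add: one_less_power)
  interpret P: residue_cochains X "int p" by unfold_locales (use p in auto)
  interpret Q: residue_cochains X "int p ^ 2" by unfold_locales (use p2 in auto)
  have S: "Suc 1 = 2" and two: "Suc (Suc 0) = 2" by simp_all
  have u': "u = range (\<lambda>e. reduce X (int p) 1 (\<lambda>x. int_coboundary X 0 e x + a x))"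
    using P.cohomology_class_reduce[of 0 a] u by simp
  have cls: "cohomology_class X P.R 2 (reduce X (int p) 2 b)
      = range (\<lambda>c. reduce X (int p) 2 (\<lambda>x. int_coboundary X 1 c x + b x))"
    using P.cohomology_class_reduce[of 1 b] by (simp add: numeral_2_eq_2)
  have "bockstein X p u \<subseteq> cohomology_class X P.R 2 (reduce X (int p) 2 b)"
  proof
    fix b' assume "b' \<in> bockstein X p u"
    then obtain a' where b': "b' \<in> carrier (cochain_group X P.R 2)"
      and a': "a' \<in> carrier (cochain_group X Q.R 1)" "reduce X (int p) 1 a' \<in> u"
      and d: "coboundary X Q.R 1 a' = (\<lambda>x\<in>simplices X 2. int p * b' x)"
      unfolding bockstein_def connecting_map_def S reduce_def by blast
    obtain e where "reduce X (int p) 1 a' = reduce X (int p) 1 (\<lambda>x. int_coboundary X 0 e x + a x)"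
      using a'(2) u' by blast
    then have "\<forall>x\<in>simplices X 1. \<exists>c. a' x = (int_coboundary X 0 e x + a x) + int p * c"
      unfolding P.reduce_eq_iff by (metis cong_iff_lin cong_sym)
    then obtain c where c: "\<And>x. x \<in> simplices X 1 \<Longrightarrow>
        a' x = (int_coboundary X 0 e x + a x) + int p * c x" by metis
    have "[b' x = int_coboundary X 1 c x + b x] (mod int p)" if x: "x \<in> simplices X 2" for x
    proof -
      have x': "x \<in> simplices X (Suc (Suc 0))" "x \<in> simplices X (Suc 1)"
        using x by (simp_all add: numeral_2_eq_2)
      have "int_coboundary X 1 a' x
          = int_coboundary X 1 (\<lambda>x. (int_coboundary X 0 e x + a x) + int p * c x) x"
        by (rule int_coboundary_cong_eq[OF x'(2) c])
      \<comment> \<open>the term \<open>de\<close> drops out since \<open>dd = 0\<close> holds integrally\<close>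
      also have "\<dots> = int p * (int_coboundary X 1 c x + b x)"
        using int_coboundary_int_coboundary[OF x'(1), of e] da[OF x]
        by (simp add: int_coboundary_add int_coboundary_mult algebra_simps)
      finally have 1: "int_coboundary X 1 a' x = int p * (int_coboundary X 1 c x + b x)" .
      have "reduce X (int p ^ 2) 2 (int_coboundary X 1 a') x = int p * b' x"
        using Q.coboundary_reduce[of 1 a'] Q.reduce_self[OF a'(1)] fun_cong[OF d, of x] x by (simp add: two)
      then have "int p * b' x mod (int p * int p) = int_coboundary X 1 a' x mod (int p * int p)"
        using x by (metis mod_mod_trivial power2_eq_square reduce_def restrict_apply')
      then show ?thesis using p unfolding 1 by (simp add: cong_def)
    qed
    then have "reduce X (int p) 2 b' = reduce X (int p) 2 (\<lambda>x. int_coboundary X 1 c x + b x)"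
      by (simp add: P.reduce_eq_iff)
    then show "b' \<in> cohomology_class X P.R 2 (reduce X (int p) 2 b)"
      unfolding cls P.reduce_self[OF b'] by blast
  qed
  moreover have "reduce X (int p) 2 (\<lambda>x. int_coboundary X 1 c x + b x) \<in> bockstein X p u" for c
    unfolding reduce_def
  proof (rule bockstein_integral_lift[where a = "\<lambda>x. a x + int p * c x"])
    \<comment> \<open>adding \<open>pc\<close> does not change the reduction mod \<open>p\<close>, which lies in \<open>u\<close> as the shift of \<open>a\<close> by \<open>d0\<close>\<close>
    have "(\<lambda>x\<in>simplices X 1. (a x + int p * c x) mod int p)
        = reduce X (int p) 1 (\<lambda>x. int_coboundary X 0 (\<lambda>_. 0) x + a x)"
      by (auto simp: reduce_def int_coboundary_def intro!: restrict_ext)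
    then show "(\<lambda>x\<in>simplices X 1. (a x + int p * c x) mod int p) \<in> u" unfolding u' by blast
    fix x assume x: "x \<in> simplices X 2"
    have "int_coboundary X 1 (\<lambda>x. a x + int p * c x) x = int p * (int_coboundary X 1 c x + b x)"
      by (simp only: int_coboundary_add int_coboundary_mult da[OF x]) (simp add: algebra_simps)
    then show "(\<Sum>i\<le>2. (-1) ^ i * (a (face X 2 i x) + int p * c (face X 2 i x)))
        = int p * (int_coboundary X 1 c x + b x)"
      by (simp only: int_coboundary_def S)
  qed (use p delta_set_axioms in auto)
  ultimately show ?thesis unfolding cls by blast
qed

section \<open>Divided powers modulo a prime\<close>

lemma binomial_middle_sum:
  fixes w y :: "'a::comm_ring_1"
  assumes "n > 0"
  shows "(\<Sum>l\<in>{1..<n}. of_nat (n choose l) * w ^ l * y ^ (n - l)) = (w + y) ^ n - w ^ n - y ^ n"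
proof -
  have "{..n} = insert 0 (insert n {1..<n})" using assms by auto
  then show ?thesis using assms unfolding binomial_ring by simp
qed

text \<open>The value \<open>(-1)\<^bsup>n+1\<^esup> t\<^bsup>n\<^esup> / n!\<close> of \<open>c\<^sub>n\<close> on an edge with \<open>A = t\<close>. The division is encoded by a
  function \<open>g\<close> of which \<open>g n\<close> is to be an inverse of \<open>n!\<close> in the modulus under consideration.\<close>

definition signed_divided_power :: "(nat \<Rightarrow> int) \<Rightarrow> nat \<Rightarrow> int \<Rightarrow> int" where
  "signed_divided_power g n t = (-1) ^ Suc n * g n * t ^ n"

lemma inverse_fact_exists:
  assumes "prime p"
  obtains g :: "nat \<Rightarrow> int" where "\<And>k. k < p \<Longrightarrow> [g k * fact k = 1] (mod int p)"
proof -
  have "\<exists>h. [h * fact k = 1] (mod int p)" if "k < p" for k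
  proof -
    have "coprime (fact k) p"
      using assms that by (metis coprime_commute prime_dvd_fact_iff not_le prime_imp_coprime)
    then have "coprime (fact k :: int) (int p)"
      by (metis coprime_int_iff of_nat_fact)
    from cong_solve_coprime_int[OF this] show ?thesis by (auto simp: mult.commute)
  qed
  then show thesis using that by metis
qed

lemma inverse_fact_mult:
  fixes g :: "nat \<Rightarrow> int"
  assumes g: "\<And>k. k < p \<Longrightarrow> [g k * fact k = 1] (mod m)" and "l \<le> n" "n < p"
  shows "[g l * g (n - l) = g n * int (n choose l)] (mod m)"
proof -
  have f: "(fact n :: int) = fact l * fact (n - l) * int (n choose l)"
    using binomial_fact_lemma[OF assms(2)] by (metis of_nat_fact of_nat_mult)
  have "[g l * g (n - l) * 1 = g l * g (n - l) * (g n * fact n)] (mod m)"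
    by (intro cong_mult cong_refl cong_sym[OF g]) (use assms in auto)
  also have "g l * g (n - l) * (g n * fact n)
      = (g l * fact l) * (g (n - l) * fact (n - l)) * (g n * int (n choose l))"
    unfolding f by (simp add: algebra_simps)
  also have "[\<dots> = 1 * 1 * (g n * int (n choose l))] (mod m)"
    by (intro cong_mult cong_refl g) (use assms in auto)
  finally show ?thesis by simp
qed

text \<open>The top case, where \<open>p!\<close> has no inverse: \<open>1 / (l! (p-l)!) \<equiv> -(1/p) (p choose l)\<close>.\<close>

lemma inverse_fact_mult_prime:
  fixes g :: "nat \<Rightarrow> int"
  assumes p: "prime p"
    and g: "\<And>k. k < p \<Longrightarrow> [g k * fact k = 1] (mod int p)" and l: "0 < l" "l < p"
  shows "[g l * g (p - l) = - int ((p choose l) div p)] (mod int p)"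
proof -
  let ?B = "(p choose l) div p"
  have B: "p choose l = p * ?B"
    using dvd_choose_prime[of l p] l p by simp
  have "p * fact (p - 1) = p * (fact l * fact (p - l) * ?B)"
    using binomial_fact_lemma[of l p] l B prime_gt_0_nat[OF p]
    by (metis fact_reduce less_imp_le mult.left_commute of_nat_id)
  then have "fact (p - 1) = fact l * fact (p - l) * ?B"
    using prime_gt_0_nat[OF p] by simp
  then have f: "(fact (p - 1) :: int) = fact l * fact (p - l) * int ?B"
    by (metis of_nat_fact of_nat_mult)
  have "[g l * g (p - l) * - 1 = g l * g (p - l) * fact (p - 1)] (mod int p)"
    by (intro cong_mult cong_refl cong_sym[OF wilson_theorem[OF p]])
  also have "g l * g (p - l) * fact (p - 1)
      = (g l * fact l) * (g (p - l) * fact (p - l)) * int ?B"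
    unfolding f by (simp add: algebra_simps)
  also have "[\<dots> = 1 * 1 * int ?B] (mod int p)"
    by (intro cong_mult cong_refl g) (use l in auto)
  finally show ?thesis using cong_minus_minus_iff by fastforce
qed

lemma signed_divided_power_mult:
  assumes "l \<le> n"
  shows "signed_divided_power g l w * signed_divided_power g (n - l) y
    = (-1) ^ n * (g l * g (n - l) * w ^ l * y ^ (n - l))"
proof -
  have "(-1::int) ^ l * (-1) ^ (n - l) = (-1) ^ n"
    using assms by (simp flip: power_add)
  then have "(-1::int) ^ l * (-1) ^ (n - l) * (g l * g (n - l) * w ^ l * y ^ (n - l))
      = (-1) ^ n * (g l * g (n - l) * w ^ l * y ^ (n - l))" by simp
  then show ?thesis by (simp add: signed_divided_power_def mult_ac)
qed

text \<open>The equation \<open>dc\<^sub>n = c\<^sub>1 c\<^bsub>n-1\<^esub> + \<dots> + c\<^bsub>n-1\<^esub> c\<^sub>1\<close> on a 2-simplex with edges \<open>w\<close>, \<open>y\<close> and long edge \<open>z\<close>.\<close>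

lemma signed_divided_power_coboundary:
  assumes g: "\<And>k. k < p \<Longrightarrow> [g k * fact k = 1] (mod m)" and n: "0 < n" "n < p"
    and z: "[z = w + y] (mod m)"
  shows "[signed_divided_power g n y - signed_divided_power g n z + signed_divided_power g n w
    = (\<Sum>l\<in>{1..<n}. signed_divided_power g l w * signed_divided_power g (n - l) y)] (mod m)"
proof -
  have "[(\<Sum>l\<in>{1..<n}. signed_divided_power g l w * signed_divided_power g (n - l) y)
      = (\<Sum>l\<in>{1..<n}. (-1) ^ n * (g n * int (n choose l) * w ^ l * y ^ (n - l)))] (mod m)"
    by (intro cong_sum, subst signed_divided_power_mult)
      (auto intro!: cong_mult[OF cong_refl] cong_mult[OF _ cong_refl] inverse_fact_mult[OF g] n)
  also have "(\<Sum>l\<in>{1..<n}. (-1) ^ n * (g n * int (n choose l) * w ^ l * y ^ (n - l)))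
      = (-1) ^ n * g n * ((w + y) ^ n - w ^ n - y ^ n)"
    unfolding binomial_middle_sum[OF n(1), symmetric] sum_distrib_left by (simp add: mult.assoc)
  also have "[\<dots> = (-1) ^ n * g n * (z ^ n - w ^ n - y ^ n)] (mod m)"
    by (intro cong_mult cong_diff cong_refl cong_pow cong_sym[OF z])
  also have "(-1) ^ n * g n * (z ^ n - w ^ n - y ^ n)
      = signed_divided_power g n y - signed_divided_power g n z + signed_divided_power g n w"
    by (simp add: signed_divided_power_def algebra_simps)
  finally show ?thesis by (rule cong_sym)
qed

lemma cong_pow_prime_square:
  fixes z s :: int
  assumes "[z = s] (mod int p)"
  shows "[z ^ p = s ^ p] (mod int p * int p)"
proof -
  have "[(\<Sum>i<p. s ^ (p - Suc i) * z ^ i) = (\<Sum>i<p. s ^ (p - Suc i) * s ^ i)] (mod int p)"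
    by (intro cong_sum cong_mult cong_pow assms cong_refl)
  also have "(\<Sum>i<p. s ^ (p - Suc i) * s ^ i) = (\<Sum>i<p. s ^ (p - 1))"
    by (intro sum.cong refl) (simp flip: power_add)
  also have "[\<dots> = 0] (mod int p)" by (simp add: cong_0_iff)
  finally have "int p dvd (\<Sum>i<p. s ^ (p - Suc i) * z ^ i)" by (simp add: cong_0_iff)
  moreover have "int p dvd z - s" using assms by (simp add: cong_iff_dvd_diff)
  ultimately show ?thesis
    by (simp add: cong_iff_dvd_diff power_diff_sumr2 mult_dvd_mono)
qed

text \<open>For \<open>n = p\<close> the sum is congruent to \<open>-b\<close>, where \<open>b = d(A\<^bsup>p\<^esup>) / p\<close>.\<close>

lemma signed_divided_power_top_sum:
  assumes p: "prime p" "odd p" and g: "\<And>k. k < p \<Longrightarrow> [g k * fact k = 1] (mod int p)"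
    and z: "[z = w + y] (mod int p)" and b: "y ^ p - z ^ p + w ^ p = int p * b"
  shows "[(\<Sum>l\<in>{1..<p}. signed_divided_power g l w * signed_divided_power g (p - l) y) = - b] (mod int p)"
proof -
  let ?B = "\<lambda>l. (p choose l) div p"
  \<comment> \<open>\<open>W = ((w + y)\<^bsup>p\<^esup> - w\<^bsup>p\<^esup> - y\<^bsup>p\<^esup>) / p\<close>\<close>
  define W where "W = (\<Sum>l\<in>{1..<p}. int (?B l) * w ^ l * y ^ (p - l))"
  have p0: "p > 0" using p(1) by (rule prime_gt_0_nat)
  have "[(\<Sum>l\<in>{1..<p}. signed_divided_power g l w * signed_divided_power g (p - l) y)
      = (\<Sum>l\<in>{1..<p}. (-1) ^ p * (- int (?B l) * w ^ l * y ^ (p - l)))] (mod int p)"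
    by (intro cong_sum, subst signed_divided_power_mult)
      (auto simp del: mult_minus_left mult_minus_right
        intro!: cong_mult[OF cong_refl] cong_mult[OF _ cong_refl] inverse_fact_mult_prime[OF p(1) g])
  also have "(\<Sum>l\<in>{1..<p}. (-1) ^ p * (- int (?B l) * w ^ l * y ^ (p - l))) = W"
    using p(2) by (simp add: W_def)
  finally have 1: "[(\<Sum>l\<in>{1..<p}. signed_divided_power g l w * signed_divided_power g (p - l) y)
      = W] (mod int p)" .
  have "int p * W = (\<Sum>l\<in>{1..<p}. int (p choose l) * w ^ l * y ^ (p - l))"
    unfolding W_def sum_distrib_left
  proof (rule sum.cong)
    fix l assume "l \<in> {1..<p}"
    then have "p choose l = p * ?B l"
      using dvd_choose_prime[of l p] p(1) by simp
    then have "int (p choose l) = int p * int (?B l)" by (metis of_nat_mult)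
    then show "int p * (int (?B l) * w ^ l * y ^ (p - l)) = int (p choose l) * w ^ l * y ^ (p - l)"
      by simp
  qed simp
  also have "\<dots> = (w + y) ^ p - w ^ p - y ^ p" by (rule binomial_middle_sum[OF p0])
  also have "[\<dots> = z ^ p - w ^ p - y ^ p] (mod int p * int p)"
    by (intro cong_diff cong_refl cong_sym[OF cong_pow_prime_square[OF z]])
  also have "z ^ p - w ^ p - y ^ p = int p * (- b)" using b by (simp add: algebra_simps)
  finally have "int p * int p dvd int p * (W - - b)"
    unfolding cong_iff_dvd_diff right_diff_distrib .
  then have "[W = - b] (mod int p)" using p0 by (simp add: cong_iff_dvd_diff)
  with 1 show ?thesis by (rule cong_trans)
qed

lemma int_fermat:
  fixes a :: int
  assumes "prime p"
  shows "[a ^ p = a] (mod int p)"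
proof -
  define r where "r = nat (a mod int p)"
  have p0: "p > 0" using assms by (rule prime_gt_0_nat)
  have r: "[a = int r] (mod int p)" using p0 by (simp add: r_def cong_def)
  have "[r ^ p = r] (mod p)"
  proof (cases "p dvd r")
    case True
    then show ?thesis using p0 by (metis cong_0_iff cong_sym cong_trans dvd_power dvd_trans)
  next
    case False
    from cong_scalar_left[OF fermat_theorem[OF assms this], of r] show ?thesis
      using p0 by (simp flip: power_Suc)
  qed
  then have "[int r ^ p = int r] (mod int p)" by (metis cong_int_iff of_nat_power)
  with r show ?thesis by (metis cong_pow cong_sym cong_trans)
qed

section \<open>The Massey product of a single class\<close>

theorem theorem9p5:
  fixes X :: "'a delta_data" and p :: nat and u :: "('a \<Rightarrow> int) set"
  assumes "delta_set X"
    and "prime p" and "odd p"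
    and "u \<in> carrier (cohomology_group X (residue_ring (int p)) 1)"
  shows "massey_product_defined X (residue_ring (int p)) p (\<lambda>_. u) \<and>
         inv\<^bsub>cohomology_group X (residue_ring (int p)) 2\<^esub> (bockstein X p u)
           \<in> massey_product X (residue_ring (int p)) p (\<lambda>_. u)"
proof -
  have p1: "p > 1" using assms(2) by (rule prime_gt_1_nat)
  interpret delta_set X by fact
  interpret P: residue_cochains X "int p" by unfold_locales (use p1 in auto)
  have two: "Suc 1 = 2" "Suc (Suc 0) = 2" by simp_all
  have face2: "face X 2 i x \<in> simplices X 1" if "x \<in> simplices X 2" "i \<le> 2" for i x
    using face_closed[of i 1 x] that two by simp
  obtain A where Z: "reduce X (int p) 1 A \<in> cocycles X P.R 1"
    and u: "u = cohomology_class X P.R 1 (reduce X (int p) 1 A)"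
    using assms(4) by (rule P.cohomology_classE)
  have z: "[A (face X 2 1 x) = A (face X 2 2 x) + A (face X 2 0 x)] (mod int p)"
    if "x \<in> simplices X 2" for x
  proof -
    have "[int_coboundary X 1 A x = 0] (mod int p)"
      using Z that unfolding P.reduce_in_cocycles two by blast
    then have "int p dvd - int_coboundary X 1 A x" by (simp add: cong_0_iff)
    then show ?thesis unfolding int_coboundary_1 by (simp add: cong_iff_dvd_diff algebra_simps)
  qed
  obtain g :: "nat \<Rightarrow> int" where g: "\<And>k. k < p \<Longrightarrow> [g k * fact k = 1] (mod int p)"
    using inverse_fact_exists[OF assms(2)] by blast

  define c where "c i j e = signed_divided_power g (Suc j - i) (A e)" for i j e
  define a where "a i j = reduce X (int p) 1 (c i j)" for i j
  have massey: "massey_sum X P.R a i j = reduce X (int p) 2 (\<lambda>x. \<Sum>l\<in>{1..<Suc j - i}.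
      signed_divided_power g l (A (face X 2 2 x)) *
      signed_divided_power g (Suc j - i - l) (A (face X 2 0 x)))" for i j
  proof -
    have "(\<Sum>k\<in>{i..<j}. c i k (face X 2 2 x) * c (Suc k) j (face X 2 0 x))
      = (\<Sum>l\<in>{1..<Suc j - i}. signed_divided_power g l (A (face X 2 2 x)) *
          signed_divided_power g (Suc j - i - l) (A (face X 2 0 x)))" for x
      unfolding c_def
      \<comment> \<open>the product \<open>a\<^bsub>i,k\<^esub> a\<^bsub>k+1,j\<^esub>\<close> is the term \<open>l = k - i + 1\<close>\<close>
      by (rule sum.reindex_bij_witness[where i = "\<lambda>l. l + i - 1" and j = "\<lambda>k. Suc k - i"])
        (auto simp: Suc_diff_le)
    then show ?thesis by (subst P.massey_sum_reduce[where b = c]) (simp_all add: a_def)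
  qed
  have system: "massey_defining_system X P.R p (\<lambda>_. u) a"
    unfolding massey_defining_system_def
  proof (intro conjI ballI allI impI)
    fix i assume "i \<in> {1..p}"
    \<comment> \<open>\<open>c\<^sub>1\<close> reduces to \<open>A\<close>, written as \<open>d0 + A\<close> to exhibit it as an element of the coset \<open>u\<close>\<close>
    have "[g 1 = 1] (mod int p)" using g[OF p1] by simp
    then have "a i i = reduce X (int p) 1 (\<lambda>x. int_coboundary X 0 (\<lambda>_. 0) x + A x)"
      unfolding a_def P.reduce_eq_iff
      by (auto simp: c_def signed_divided_power_def int_coboundary_def
          intro: cong_scalar_right[where c = 1, simplified] dest: cong_scalar_right)
    then show "a i i \<in> u"
      using u P.cohomology_class_reduce[of 0 A] by auto
  next
    fix i j assume ij: "1 \<le> i \<and> i < j \<and> j \<le> p \<and> (i, j) \<noteq> (1, p)"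
    show "a i j \<in> carrier (cochain_group X P.R 1)" unfolding a_def by (rule P.reduce_in_carrier)
    have n: "0 < Suc j - i" "Suc j - i < p" using ij by auto
    show "coboundary X P.R 1 (a i j) = massey_sum X P.R a i j"
      unfolding massey unfolding a_def P.coboundary_reduce two P.reduce_eq_iff int_coboundary_1 c_def
      by (intro ballI signed_divided_power_coboundary[OF g n z])
  qed

  \<comment> \<open>The Bockstein is computed with the lift \<open>A\<^bsup>p\<^esup>\<close> rather than \<open>A\<close>, so that it matches the Massey
    cocycle exactly and not only up to a coboundary.\<close>
  have "\<exists>b. int_coboundary X 1 (\<lambda>e. A e ^ p) x = int p * b" if x: "x \<in> simplices X 2" for x
  proof -
    have "[int_coboundary X 1 (\<lambda>e. A e ^ p) x = int_coboundary X 1 A x] (mod int p)"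
      by (rule int_coboundary_cong) (use x in \<open>auto simp: numeral_2_eq_2 int_fermat[OF assms(2)]\<close>)
    also have "[int_coboundary X 1 A x = 0] (mod int p)"
      using Z x unfolding P.reduce_in_cocycles two by blast
    finally show ?thesis by (auto simp: cong_0_iff)
  qed
  then obtain b where b: "\<And>x. x \<in> simplices X 2 \<Longrightarrow>
      int_coboundary X 1 (\<lambda>e. A e ^ p) x = int p * b x" by metis
  have lift: "reduce X (int p) 1 (\<lambda>e. A e ^ p) = reduce X (int p) 1 A"
    by (simp add: P.reduce_eq_iff int_fermat[OF assms(2)])
  have bock: "bockstein X p u = cohomology_class X P.R 2 (reduce X (int p) 2 b)"
    by (rule bockstein_eq_cohomology_class[OF p1 _ b]) (simp_all only: u lift)
  have cocycle: "reduce X (int p) 2 b \<in> cocycles X P.R 2"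
    unfolding P.reduce_in_cocycles
  proof
    fix x assume x: "x \<in> simplices X (Suc 2)"
    \<comment> \<open>\<open>p db = dd(A\<^bsup>p\<^esup>) = 0\<close> over \<open>\<int>\<close>, and \<open>p\<close> can be cancelled there\<close>
    then have "int p * int_coboundary X 2 b x
        = int_coboundary X 2 (int_coboundary X 1 (\<lambda>e. A e ^ p)) x"
      unfolding int_coboundary_mult[symmetric] by (intro int_coboundary_cong_eq) (simp_all only: b)
    also have "\<dots> = 0"
      using int_coboundary_int_coboundary[of x 1] x by (simp add: numeral_2_eq_2)
    finally show "[int_coboundary X 2 b x = 0] (mod int p)" using p1 by simp
  qed
  have "massey_sum X P.R a 1 p = reduce X (int p) 2 (\<lambda>x. - b x)"
    unfolding massey P.reduce_eq_iff diff_Suc_1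
    by (intro ballI signed_divided_power_top_sum[OF assms(2,3) g z b[unfolded int_coboundary_1]])
      simp_all
  then have "inv\<^bsub>cohomology_group X P.R 2\<^esub> (bockstein X p u)
      = cohomology_class X P.R 2 (massey_sum X P.R a 1 p)"
    using P.inv_cohomology_class[of 1 b] cocycle bock by (simp add: two)
  with system show ?thesis
    unfolding massey_product_defined_def massey_product_def by blast
qed

end
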